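(* Let $\theta^*\in\mathbb{R}^n$, let $\phi:\mathbb{R}_{\ge0}\to\mathbb{R}^n$ be piecewise continuous with $|\phi(t)|\le M$ for all $t\ge0$ (some $M>0$), and $y^*(t):=\phi^T(t)\theta^*$. Let $t_1,\dots,t_N\ge0$ be such that $\mathcal{D}=[\phi(t_1),\dots,\phi(t_N)]$ has rank $n$. Let $\beta,\gamma,\mu>0$ with $\beta\ge2\gamma/\mu$, $\mathcal{N}_t:=1+\mu\phi^T(t)\phi(t)$, and $$B(\theta,\mu):=\sum_{k=1}^N\frac{\phi(t_k)}{1+\mu\phi^T(t_k)\phi(t_k)}\big(\phi^T(t_k)\theta-y^*(t_k)\big).$$ Then $(\theta^*,\theta^* )$ is uniformly globally asymptotically stable for the system in $(\theta,\vartheta)\in\mathbb{R}^{2n}$ $$\dot\theta=-\beta(\theta-\vartheta),\qquad\dot\vartheta=-\gamma\Big(\frac{1}{\mathcal{N}_t}\phi(t)\big(\phi^T(t)\theta-y^*(t)\big)+B(\theta,\mu)\Big).$$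
   Context: No persistent excitation is assumed. For a system $\dot x=f(x,t)$ with equilibrium $x^*$: uniformly globally stable (UGS) means there is a class-$\mathcal{K}_\infty$ function $\kappa$ with $|x(t)-x^*|\le\kappa(|x_\circ-x^*|)$ for all $t\ge t_\circ$, for every solution from every $(x_\circ,t_\circ)$; uniformly globally attractive (UGA) means for each $r,\sigma>0$ there is $T'>0$ with $|x_\circ-x^*|\le r\Rightarrow|x(t)-x^*|\le\sigma$ for all $t\ge t_\circ+T'$, uniformly in $t_\circ\ge0$; UGAS means UGS and UGA. *)

theory Defs
  imports "HOL-Analysis.Analysis"
begin

text \<open>Class-K-infinity functions on the nonnegative reals.\<close>
definition class_K_inf :: "(real \<Rightarrow> real) \<Rightarrow> bool" where
  "class_K_inf \<kappa> \<longleftrightarrow> continuous_on {0..} \<kappa> \<and> \<kappa> 0 = 0 \<and>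
     strict_mono_on {0..} \<kappa> \<and> filterlim \<kappa> at_top at_top"

text \<open>Piecewise continuity on the half line t >= 0: on every compact interval
  there are only finitely many discontinuities, and at each of them the
  one-sided limits exist.\<close>
definition piecewise_continuous_nonneg :: "(real \<Rightarrow> 'a::topological_space) \<Rightarrow> bool" where
  "piecewise_continuous_nonneg \<phi> \<longleftrightarrow>
     (\<forall>T\<ge>0. \<exists>S. finite S \<and>
        (\<forall>t\<in>{0..T} - S. continuous (at t within {0..}) \<phi>) \<and>
        (\<forall>s\<in>S. s > 0 \<longrightarrow> (\<exists>l. (\<phi> \<longlongrightarrow> l) (at_left s))) \<and>
        (\<forall>s\<in>S. \<exists>l. (\<phi> \<longlongrightarrow> l) (at_right s)))"

text \<open>A (Caratheodory) solution of x' = f x t on [t0, infinity), in integral form.\<close>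
definition is_solution ::
  "('x::euclidean_space \<Rightarrow> real \<Rightarrow> 'x) \<Rightarrow> real \<Rightarrow> (real \<Rightarrow> 'x) \<Rightarrow> bool" where
  "is_solution f t0 x \<longleftrightarrow>
     (\<forall>t\<ge>t0. ((\<lambda>s. f (x s) s) has_integral (x t - x t0)) {t0..t})"

definition UGS :: "('x::euclidean_space \<Rightarrow> real \<Rightarrow> 'x) \<Rightarrow> 'x \<Rightarrow> bool" where
  "UGS f xs \<longleftrightarrow> (\<exists>\<kappa>. class_K_inf \<kappa> \<and>
     (\<forall>t0\<ge>0. \<forall>x. is_solution f t0 x \<longrightarrow>
        (\<forall>t\<ge>t0. norm (x t - xs) \<le> \<kappa> (norm (x t0 - xs)))))"

definition UGA :: "('x::euclidean_space \<Rightarrow> real \<Rightarrow> 'x) \<Rightarrow> 'x \<Rightarrow> bool" where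
  "UGA f xs \<longleftrightarrow> (\<forall>r>0. \<forall>\<sigma>>0. \<exists>T'>0.
     \<forall>t0\<ge>0. \<forall>x. is_solution f t0 x \<longrightarrow> norm (x t0 - xs) \<le> r \<longrightarrow>
        (\<forall>t\<ge>t0 + T'. norm (x t - xs) \<le> \<sigma>))"

definition UGAS :: "('x::euclidean_space \<Rightarrow> real \<Rightarrow> 'x) \<Rightarrow> 'x \<Rightarrow> bool" where
  "UGAS f xs \<longleftrightarrow> UGS f xs \<and> UGA f xs"

end

theory Submission
  imports Defs
begin

text \<open>In the coordinates \<open>e = \<theta> - \<theta>*\<close>, \<open>z = \<theta> - \<vartheta>\<close> the function
  \<open>V = |\<vartheta> - \<theta>*|\<^sup>2/2 + |z|\<^sup>2/2 + (\<gamma>/\<beta>) \<Sum>\<^sub>k (\<phi>\<^sub>k\<^sup>T e)\<^sup>2 / \<N>\<^sub>k\<close>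
  is a strict Lyapunov function. Along the flow the cross terms coming from the stored data cancel
  (this is what the factor \<open>\<gamma>/\<beta>\<close> is for), and the normalisation gives
  \<open>|\<phi>(t)|\<^sup>2 / \<N>\<^sub>t \<le> 1/\<mu>\<close>, so that
  \<open>V' \<le> -\<gamma> \<Sum>\<^sub>k (\<phi>\<^sub>k\<^sup>T e)\<^sup>2 / \<N>\<^sub>k - (\<beta> - \<gamma>/\<mu>) |z|\<^sup>2\<close>.
  The rank condition makes the data sum positive definite in \<open>e\<close> and \<open>\<beta> \<ge> 2\<gamma>/\<mu>\<close> gives
  \<open>\<beta> - \<gamma>/\<mu> \<ge> \<gamma>/\<mu>\<close>; hence \<open>V' \<le> -\<kappa> V\<close> with \<open>\<kappa>\<close> independent of \<open>t\<close>, and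
  solutions decay exponentially, uniformly in the initial time. No bound on \<open>\<phi>\<close> is needed:
  along a (Caratheodory) solution \<open>V\<close> is differentiable off the finitely many discontinuities of
  \<open>\<phi>\<close> in each compact interval, which suffices for the comparison argument.\<close>

lemma norm_add_power2_le:
  fixes u v :: "'a::real_inner"
  shows "norm (u + v)^2 \<le> 2 * norm u ^2 + 2 * norm v ^2"
proof -
  have "0 \<le> norm (u - v)^2" by simp
  thus ?thesis
    by (simp add: power2_norm_eq_inner inner_add_left inner_add_right inner_diff_left
        inner_diff_right inner_commute)
qed

lemma full_rank_sum_inner_power2_ge:
  fixes p :: "'m::finite \<Rightarrow> real^'n" and w :: "'m \<Rightarrow> real"
  assumes rank: "rank ((\<chi> i k. p k $ i) :: real^'m^'n) = CARD('n)"
    and w_pos: "\<And>k. w k > 0"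
  shows "\<exists>c>0. \<forall>e. c * norm e ^ 2 \<le> (\<Sum>k\<in>UNIV. w k * (p k \<bullet> e)^2)"
proof -
  define D where "D = ((\<chi> i k. p k $ i) :: real^'m^'n)"
  have "inj ((*v) (transpose D))"
    using rank full_rank_injective rank_transpose unfolding D_def by metis
  moreover have D: "transpose D *v e = (\<chi> k. p k \<bullet> e)" for e
    by (simp add: D_def transpose_def matrix_vector_mult_def inner_vec_def vec_eq_iff mult.commute)
  ultimately have p_inj: "e = 0" if "\<And>k. p k \<bullet> e = 0" for e
  proof -
    have "transpose D *v e = transpose D *v 0" using that unfolding D by (simp add: vec_eq_iff)
    thus ?thesis using \<open>inj ((*v) (transpose D))\<close> unfolding inj_def by blast
  qed
  define L where "L e = (\<chi> k. sqrt (w k) * (p k \<bullet> e))" for e :: "real^'n"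
  have lin: "bounded_linear L"
    unfolding linear_conv_bounded_linear[symmetric]
    by (rule linearI) (simp_all add: L_def vec_eq_iff inner_add_right algebra_simps)
  have L_inj: "e = 0" if "L e = 0" for e
  proof (rule p_inj)
    fix k
    have "sqrt (w k) * (p k \<bullet> e) = 0" using that by (simp add: L_def vec_eq_iff)
    thus "p k \<bullet> e = 0" using w_pos[of k] by simp
  qed
  obtain c where c: "c > 0" "\<And>e. c * norm e \<le> norm (L e)"
    using injective_imp_isometric[OF closed_UNIV subspace_UNIV lin] L_inj by blast
  have L_norm: "norm (L e)^2 = (\<Sum>k\<in>UNIV. w k * (p k \<bullet> e)^2)" for e
  proof -
    have "norm (L e)^2 = (\<Sum>k\<in>UNIV. (sqrt (w k) * (p k \<bullet> e))^2)"
      unfolding power2_norm_eq_inner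
      by (simp only: inner_vec_def L_def vec_lambda_beta power2_eq_square inner_real_def)
    thus ?thesis using w_pos by (simp add: power_mult_distrib less_imp_le)
  qed
  have "c^2 * norm e ^ 2 \<le> (\<Sum>k\<in>UNIV. w k * (p k \<bullet> e)^2)" for e
    using power_mono[OF c(2)[of e], of 2] c(1) by (simp add: power_mult_distrib flip: L_norm)
  thus ?thesis using c(1) by (intro exI[of _ "c^2"]) auto
qed

lemma le_if_real_derivative_nonpos_off_finite:
  fixes W W' :: "real \<Rightarrow> real"
  assumes "a \<le> b" and "finite S" and "continuous_on {a..b} W"
    and "\<And>s. s \<in> {a..b} - S \<Longrightarrow> (W has_real_derivative W' s) (at s within {a..b})"
    and "\<And>s. s \<in> {a..b} - S \<Longrightarrow> W' s \<le> 0"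
  shows "W b \<le> W a"
proof -
  let ?f = "\<lambda>s. if s \<in> S then 0 else W' s"
  have "(?f has_integral (W b - W a)) {a..b}"
  proof (rule fundamental_theorem_of_calculus_interior_strong[OF assms(2,1)])
    fix s assume s: "s \<in> {a<..<b} - S"
    hence "(W has_real_derivative W' s) (at s within {a..b})" using assms(4) by auto
    moreover have "at s within {a..b} = at s" using s by (intro at_within_Icc_at) auto
    ultimately show "(W has_vector_derivative ?f s) (at s)" using s
      by (simp add: has_real_derivative_iff_has_vector_derivative)
  qed (rule assms(3))
  moreover have "?f s \<le> 0" if "s \<in> {a..b}" for s using assms(5) that by auto
  ultimately have "W b - W a \<le> 0"
    using has_integral_le[of ?f "W b - W a" "{a..b}" "\<lambda>_. 0" 0] by auto
  thus ?thesis by simp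
qed

lemma is_solution_eq_integral:
  assumes "is_solution f t0 x" and "t0 \<le> t"
  shows "x t = x t0 + integral {t0..t} (\<lambda>s. f (x s) s)"
proof -
  have "((\<lambda>s. f (x s) s) has_integral (x t - x t0)) {t0..t}"
    using assms unfolding is_solution_def by blast
  thus ?thesis by (simp add: integral_unique)
qed

lemma is_solution_continuous_on:
  assumes sol: "is_solution f t0 x"
  shows "continuous_on {t0..t} x"
proof -
  have "(\<lambda>s. f (x s) s) integrable_on {t0..t}"
    using sol unfolding is_solution_def by (cases "t0 \<le> t") auto
  hence "continuous_on {t0..t} (\<lambda>u. x t0 + integral {t0..u} (\<lambda>s. f (x s) s))"
    by (intro continuous_intros indefinite_integral_continuous_1)
  thus ?thesis
    by (rule continuous_on_eq) (simp add: is_solution_eq_integral[OF sol, symmetric])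
qed

lemma is_solution_has_vector_derivative:
  assumes sol: "is_solution f t0 x" and s: "s \<in> {t0..t}"
    and cont: "continuous (at s within {t0..t}) (\<lambda>u. f (x u) u)"
  shows "(x has_vector_derivative f (x s) s) (at s within {t0..t})"
proof -
  have "(\<lambda>s. f (x s) s) integrable_on {t0..t}"
    using sol s unfolding is_solution_def
    by (meson atLeastAtMost_iff dual_order.trans has_integral_integrable)
  hence "((\<lambda>u. x t0 + integral {t0..u} (\<lambda>s. f (x s) s)) has_vector_derivative f (x s) s)
      (at s within {t0..t})"
    using integral_has_vector_derivative_continuous_at[of _ t0 t s "{}"] s cont
    by (auto intro!: derivative_eq_intros)
  thus ?thesis
    by (rule has_vector_derivative_transform[OF s, rotated])
      (simp add: is_solution_eq_integral[OF sol, symmetric])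
qed

definition piecewise_continuous_in_time :: "('x::topological_space \<Rightarrow> real \<Rightarrow> 'y::topological_space) \<Rightarrow> bool" where
  "piecewise_continuous_in_time f \<longleftrightarrow>
     (\<forall>T\<ge>0. \<exists>S. finite S \<and> (\<forall>s\<in>{0..T} - S. \<forall>y A. A \<subseteq> {0..} \<longrightarrow>
        continuous (at s within A) y \<longrightarrow> continuous (at s within A) (\<lambda>u. f (y u) u)))"

lemma lyapunov_exponential_decay:
  fixes f :: "'x::euclidean_space \<Rightarrow> real \<Rightarrow> 'x" and V :: "'x \<Rightarrow> real"
  assumes f: "piecewise_continuous_in_time f"
    and V: "\<And>q. (V has_derivative DV q) (at q)"
    and decrease: "\<And>q t. 0 \<le> t \<Longrightarrow> DV q (f q t) \<le> - \<kappa> * V q"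
    and sol: "is_solution f t0 x" and t0: "0 \<le> t0" and t: "t0 \<le> t"
  shows "V (x t) \<le> exp (- \<kappa> * (t - t0)) * V (x t0)"
proof -
  obtain S where "finite S" and S: "\<And>s y A. s \<in> {0..t} - S \<Longrightarrow> A \<subseteq> {0..} \<Longrightarrow>
      continuous (at s within A) y \<Longrightarrow> continuous (at s within A) (\<lambda>u. f (y u) u)"
    using f t0 t unfolding piecewise_continuous_in_time_def by (meson order_trans)
  have x_cont: "continuous_on {t0..t} x" by (rule is_solution_continuous_on[OF sol])
  define W where "W s = exp (\<kappa> * s) * V (x s)" for s
  define W' where "W' s = exp (\<kappa> * s) * (\<kappa> * V (x s) + DV (x s) (f (x s) s))" for s
  have "W t \<le> W t0"
  proof (rule le_if_real_derivative_nonpos_off_finite[OF t \<open>finite S\<close>, where W' = W'])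
    have "continuous_on UNIV V"
      using V has_derivative_continuous by (blast intro: continuous_at_imp_continuous_on)
    then show "continuous_on {t0..t} W"
      unfolding W_def by (intro continuous_intros continuous_on_compose2[OF _ x_cont]) auto
  next
    fix s assume s: "s \<in> {t0..t} - S"
    have "continuous (at s within {t0..t}) x"
      using x_cont s by (simp add: continuous_on_eq_continuous_within)
    hence "continuous (at s within {t0..t}) (\<lambda>u. f (x u) u)"
      using S s t0 by auto
    hence x': "(x has_vector_derivative f (x s) s) (at s within {t0..t})"
      using is_solution_has_vector_derivative[OF sol] s by blast
    have "DV (x s) (h *\<^sub>R v) = h * DV (x s) v" for h v
      using has_derivative_linear[OF V] by (simp add: linear_cmul)
    hence "((\<lambda>u. V (x u)) has_real_derivative DV (x s) (f (x s) s)) (at s within {t0..t})"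
      using has_derivative_compose[OF x'[unfolded has_vector_derivative_def] V]
      by (simp add: has_field_derivative_def mult.commute[of _ "DV (x s) (f (x s) s)"])
    then show "(W has_real_derivative W' s) (at s within {t0..t})"
      unfolding W_def W'_def by (auto intro!: derivative_eq_intros simp: algebra_simps)
    show "W' s \<le> 0"
      using decrease[of s "x s"] s t0 by (simp add: W'_def mult_nonneg_nonpos)
  qed
  hence "exp (- \<kappa> * t) * W t \<le> exp (- \<kappa> * t) * W t0" by simp
  thus ?thesis
    by (simp add: W_def mult.assoc[symmetric] flip: exp_add) (simp add: algebra_simps)
qed

lemma UGAS_if_exponential_bound:
  fixes f :: "'x::euclidean_space \<Rightarrow> real \<Rightarrow> 'x"
  assumes C: "C > 0" and \<alpha>: "\<alpha> > 0"
    and bound: "\<And>t0 x t. 0 \<le> t0 \<Longrightarrow> is_solution f t0 x \<Longrightarrow> t0 \<le> t \<Longrightarrow>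
       norm (x t - xs) \<le> C * exp (- \<alpha> * (t - t0)) * norm (x t0 - xs)"
  shows "UGAS f xs"
  unfolding UGAS_def
proof
  show "UGS f xs"
    unfolding UGS_def
  proof (intro exI conjI allI impI)
    show "class_K_inf (\<lambda>r. C * r)"
      using C unfolding class_K_inf_def strict_mono_on_def
      by (auto intro!: continuous_intros filterlim_tendsto_pos_mult_at_top filterlim_ident)
    fix t0 x t assume t0: "0 \<le> t0" and sol: "is_solution f t0 x" and t: "t0 \<le> t"
    have "exp (- \<alpha> * (t - t0)) * norm (x t0 - xs) \<le> norm (x t0 - xs)"
      using \<alpha> t by (intro mult_left_le_one_le) auto
    hence "C * exp (- \<alpha> * (t - t0)) * norm (x t0 - xs) \<le> C * norm (x t0 - xs)"
      using C by (simp add: mult.assoc)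
    with bound[OF t0 sol t] show "norm (x t - xs) \<le> C * norm (x t0 - xs)" by linarith
  qed
  show "UGA f xs"
    unfolding UGA_def
  proof (intro allI impI)
    fix r \<sigma> :: real assume r: "r > 0" and \<sigma>: "\<sigma> > 0"
    define T where "T = 1 + \<bar>ln (C * r / \<sigma>)\<bar> / \<alpha>"
    have T: "T > 0" using \<alpha> by (simp add: T_def add_pos_nonneg)
    have decayed: "C * exp (- \<alpha> * T) * r \<le> \<sigma>"
    proof -
      have "- \<alpha> * T \<le> - ln (C * r / \<sigma>)" using \<alpha> by (simp add: T_def algebra_simps)
      hence "exp (- \<alpha> * T) \<le> exp (- ln (C * r / \<sigma>))" by simp
      also have "\<dots> = \<sigma> / (C * r)" using C r \<sigma> by (simp add: exp_minus)
      finally show ?thesis using C r by (simp add: field_simps)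
    qed
    show "\<exists>T'>0. \<forall>t0\<ge>0. \<forall>x. is_solution f t0 x \<longrightarrow> norm (x t0 - xs) \<le> r \<longrightarrow>
        (\<forall>t\<ge>t0 + T'. norm (x t - xs) \<le> \<sigma>)"
    proof (intro exI[of _ T] conjI T allI impI)
      fix t0 x t assume t0: "0 \<le> t0" and sol: "is_solution f t0 x"
        and x0: "norm (x t0 - xs) \<le> r" and t: "t0 + T \<le> t"
      have "norm (x t - xs) \<le> C * exp (- \<alpha> * (t - t0)) * norm (x t0 - xs)"
        using bound[OF t0 sol] t T by simp
      also have "\<dots> \<le> C * exp (- \<alpha> * T) * r"
        using C \<alpha> t x0 by (intro mult_mono mult_left_mono) auto
      finally show "norm (x t - xs) \<le> \<sigma>" using decayed by linarith
    qed
  qed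
qed

lemma UGAS_if_quadratic_lyapunov:
  fixes f :: "'x::euclidean_space \<Rightarrow> real \<Rightarrow> 'x" and V :: "'x \<Rightarrow> real"
  assumes f: "piecewise_continuous_in_time f"
    and V: "\<And>q. (V has_derivative DV q) (at q)"
    and decrease: "\<And>q t. 0 \<le> t \<Longrightarrow> DV q (f q t) \<le> - \<kappa> * V q" and \<kappa>: "\<kappa> > 0"
    and a: "a > 0" and lower: "\<And>q. a * norm (q - xs)^2 \<le> V q"
    and upper: "\<And>q. V q \<le> b * norm (q - xs)^2"
  shows "UGAS f xs"
proof (rule UGAS_if_exponential_bound)
  have "a \<le> b"
    using order_trans[OF lower upper, of "xs + One"] by simp
  thus "sqrt (b / a) > 0" using a by simp
  show "\<kappa> / 2 > 0" using \<kappa> by simp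
  fix t0 x t assume t0: "0 \<le> t0" and sol: "is_solution f t0 x" and t: "t0 \<le> t"
  have "a * norm (x t - xs)^2 \<le> exp (- \<kappa> * (t - t0)) * V (x t0)"
    using lower[of "x t"] lyapunov_exponential_decay[OF f V decrease sol t0 t] by linarith
  also have "\<dots> \<le> exp (- \<kappa> * (t - t0)) * (b * norm (x t0 - xs)^2)"
    using upper by (simp add: mult_left_mono)
  finally have "norm (x t - xs)^2 \<le> b / a * exp (- \<kappa> * (t - t0)) * norm (x t0 - xs)^2"
    using a by (simp add: field_simps)
  also have "\<dots> = (sqrt (b / a) * exp (- (\<kappa> / 2) * (t - t0)) * norm (x t0 - xs))^2"
    using a \<open>a \<le> b\<close> by (simp add: power_mult_distrib flip: exp_double)
  finally show "norm (x t - xs) \<le> sqrt (b / a) * exp (- (\<kappa> / 2) * (t - t0)) * norm (x t0 - xs)"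
    by (rule power2_le_imp_le) (use a \<open>a \<le> b\<close> in simp)
qed

lemma power2_norm_diff_Pair:
  "norm (q - (a, b))^2 = norm (fst q - a)^2 + norm (snd q - b)^2"
  by (cases q) (simp add: norm_Pair)

locale concurrent_learning =
  fixes \<theta>s :: "real^'n" and \<phi> :: "real \<Rightarrow> real^'n" and ts :: "'m::finite \<Rightarrow> real"
    and \<beta> \<gamma> \<mu> :: real
  assumes \<phi>_pc: "piecewise_continuous_nonneg \<phi>"
    and rank_D: "rank ((\<chi> i k. \<phi> (ts k) $ i) :: real^'m^'n) = CARD('n)"
    and \<beta>_pos: "\<beta> > 0" and \<gamma>_pos: "\<gamma> > 0" and \<mu>_pos: "\<mu> > 0"
    and \<beta>_ge: "\<beta> \<ge> 2 * \<gamma> / \<mu>"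
begin

definition vector_field :: "(real^'n) \<times> (real^'n) \<Rightarrow> real \<Rightarrow> (real^'n) \<times> (real^'n)" where
  "vector_field = (\<lambda>(\<theta>, \<theta>v) t.
       let ys = (\<lambda>s. \<phi> s \<bullet> \<theta>s);
           B = (\<Sum>k\<in>UNIV. (1 / (1 + \<mu> * (\<phi> (ts k) \<bullet> \<phi> (ts k)))) *\<^sub>R
                   ((\<phi> (ts k) \<bullet> \<theta> - ys (ts k)) *\<^sub>R \<phi> (ts k)))
       in (- \<beta> *\<^sub>R (\<theta> - \<theta>v),
           - \<gamma> *\<^sub>R ((1 / (1 + \<mu> * (\<phi> t \<bullet> \<phi> t))) *\<^sub>R
                        ((\<phi> t \<bullet> \<theta> - ys t) *\<^sub>R \<phi> t) + B)))"

definition weight :: "real^'n \<Rightarrow> real" where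
  "weight v = 1 / (1 + \<mu> * (v \<bullet> v))"

definition data_energy :: "real^'n \<Rightarrow> real" where
  "data_energy e = (\<Sum>k\<in>UNIV. weight (\<phi> (ts k)) * (\<phi> (ts k) \<bullet> e)^2)"

lemma vector_field_eq:
  "vector_field q t = (- \<beta> *\<^sub>R (fst q - snd q),
     - \<gamma> *\<^sub>R (weight (\<phi> t) *\<^sub>R ((\<phi> t \<bullet> (fst q - \<theta>s)) *\<^sub>R \<phi> t)
        + (\<Sum>k\<in>UNIV. weight (\<phi> (ts k)) *\<^sub>R ((\<phi> (ts k) \<bullet> (fst q - \<theta>s)) *\<^sub>R \<phi> (ts k)))))"
  by (cases q) (simp add: vector_field_def weight_def Let_def inner_diff_right)

lemma weight_denominator_ge_one: "1 + \<mu> * (v \<bullet> v) \<ge> 1"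
  using \<mu>_pos by simp

lemma weight_pos: "weight v > 0"
  using weight_denominator_ge_one[of v] by (simp add: weight_def)

lemma weight_le_one: "weight v \<le> 1"
  using weight_denominator_ge_one[of v] by (simp add: weight_def)

lemma weight_mult_inner_le: "weight v * (v \<bullet> v) \<le> 1 / \<mu>"
proof -
  have "\<mu> * (v \<bullet> v) / (1 + \<mu> * (v \<bullet> v)) \<le> 1"
    using weight_denominator_ge_one[of v] by (subst divide_le_eq_1) auto
  thus ?thesis using \<mu>_pos by (simp add: weight_def field_simps)
qed

lemma data_energy_nonneg: "0 \<le> data_energy e"
  unfolding data_energy_def using weight_pos by (intro sum_nonneg) (simp add: less_imp_le)

lemma data_energy_le: "data_energy e \<le> (\<Sum>k\<in>UNIV. norm (\<phi> (ts k))^2) * norm e ^ 2"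
  unfolding data_energy_def sum_distrib_right
proof (rule sum_mono)
  fix k
  have "(\<phi> (ts k) \<bullet> e)^2 \<le> (norm (\<phi> (ts k)) * norm e)^2"
    using Cauchy_Schwarz_ineq2 abs_ge_zero power2_abs power_mono by metis
  moreover have "weight (\<phi> (ts k)) * (\<phi> (ts k) \<bullet> e)^2 \<le> (\<phi> (ts k) \<bullet> e)^2"
    using weight_le_one weight_pos by (simp add: mult_left_le_one_le less_imp_le)
  ultimately show "weight (\<phi> (ts k)) * (\<phi> (ts k) \<bullet> e)^2 \<le> norm (\<phi> (ts k))^2 * norm e ^ 2"
    by (simp add: power_mult_distrib)
qed

lemma data_energy_coercive: "\<exists>c>0. \<forall>e. c * norm e ^ 2 \<le> data_energy e"
  using full_rank_sum_inner_power2_ge[OF rank_D weight_pos] unfolding data_energy_def .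

text \<open>A state \<open>q\<close> is the pair \<open>(\<theta>, \<vartheta>)\<close>; the Lyapunov function is written in the coordinates
  \<open>fst q - \<theta>s = \<theta> - \<theta>*\<close> and \<open>fst q - snd q = \<theta> - \<vartheta>\<close>.\<close>

definition lyapunov :: "(real^'n) \<times> (real^'n) \<Rightarrow> real" where
  "lyapunov q = norm (snd q - \<theta>s)^2 / 2 + norm (fst q - snd q)^2 / 2
     + \<gamma> / \<beta> * data_energy (fst q - \<theta>s)"

definition lyapunov_deriv :: "(real^'n) \<times> (real^'n) \<Rightarrow> (real^'n) \<times> (real^'n) \<Rightarrow> real" where
  "lyapunov_deriv q d = (snd q - \<theta>s) \<bullet> snd d + (fst q - snd q) \<bullet> (fst d - snd d)
     + 2 * \<gamma> / \<beta> * (\<Sum>k\<in>UNIV. weight (\<phi> (ts k)) * (\<phi> (ts k) \<bullet> (fst q - \<theta>s)) * (\<phi> (ts k) \<bullet> fst d))"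

lemma has_derivative_lyapunov: "(lyapunov has_derivative lyapunov_deriv q) (at q)"
  unfolding lyapunov_def[abs_def] lyapunov_deriv_def[abs_def] data_energy_def power2_norm_eq_inner
  unfolding power2_eq_square
  by (rule has_derivative_eq_rhs, (rule derivative_eq_intros refl | simp)+)
    (simp add: fun_eq_iff inner_commute[of _ "snd q - \<theta>s"] inner_commute[of _ "fst q - snd q"]
      sum_distrib_left mult_ac)

lemma lyapunov_deriv_vector_field:
  "lyapunov_deriv q (vector_field q t)
     \<le> - \<gamma> * data_energy (fst q - \<theta>s) - (\<beta> - \<gamma> / \<mu>) * norm (fst q - snd q)^2"
proof -
  define e where "e = fst q - \<theta>s"
  define z where "z = fst q - snd q"
  define w where "w = weight (\<phi> t)"
  define a where "a = \<phi> t \<bullet> e"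
  define b where "b = \<phi> t \<bullet> z"
  define X where "X = (\<Sum>k\<in>UNIV. weight (\<phi> (ts k)) * (\<phi> (ts k) \<bullet> e) * (\<phi> (ts k) \<bullet> z))"
  define G where "G = w *\<^sub>R (a *\<^sub>R \<phi> t)
    + (\<Sum>k\<in>UNIV. weight (\<phi> (ts k)) *\<^sub>R ((\<phi> (ts k) \<bullet> e) *\<^sub>R \<phi> (ts k)))"
  have field_at: "vector_field q t = (- \<beta> *\<^sub>R z, - \<gamma> *\<^sub>R G)"
    by (simp add: vector_field_eq G_def w_def a_def e_def z_def)
  have eG: "e \<bullet> G = w * a^2 + data_energy e"
    by (simp add: G_def a_def data_energy_def inner_add_right inner_sum_right power2_eq_square
        inner_commute mult_ac)
  have zG: "z \<bullet> G = w * a * b + X"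
    by (simp add: G_def a_def b_def X_def inner_add_right inner_sum_right inner_commute mult_ac)
  have data_cross: "(\<Sum>k\<in>UNIV. weight (\<phi> (ts k)) * (\<phi> (ts k) \<bullet> e) * (\<phi> (ts k) \<bullet> (- \<beta> *\<^sub>R z)))
      = - \<beta> * X"
    by (simp add: X_def sum_distrib_left mult_ac)
  have "snd q - \<theta>s = e - z" by (simp add: e_def z_def)
  hence "lyapunov_deriv q (vector_field q t)
      = (e - z) \<bullet> (- \<gamma> *\<^sub>R G) + z \<bullet> (- \<beta> *\<^sub>R z - - \<gamma> *\<^sub>R G) + 2 * \<gamma> / \<beta> * (- \<beta> * X)"
    unfolding lyapunov_deriv_def field_at fst_conv snd_conv e_def[symmetric] z_def[symmetric] data_cross
    by simp
  \<comment> \<open>the data cross terms \<open>X\<close> cancel\<close>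
  also have "\<dots> = - \<gamma> * w * a^2 + \<gamma> * w * (2 * a * b) - \<gamma> * data_energy e - \<beta> * norm z ^ 2"
    using \<beta>_pos by (simp add: inner_diff_left inner_diff_right eG zG power2_norm_eq_inner algebra_simps)
  also have "\<dots> \<le> - \<gamma> * data_energy e - (\<beta> - \<gamma> / \<mu>) * norm z ^ 2"
  proof -
    have "b^2 \<le> (norm (\<phi> t) * norm z)^2"
      unfolding b_def using Cauchy_Schwarz_ineq2 abs_ge_zero power2_abs power_mono by metis
    hence "w * b^2 \<le> (w * (\<phi> t \<bullet> \<phi> t)) * norm z ^ 2"
      using weight_pos by (simp add: w_def power_mult_distrib power2_norm_eq_inner[symmetric] mult.assoc)
    also have "\<dots> \<le> norm z ^ 2 / \<mu>"
      using weight_mult_inner_le[of "\<phi> t"] mult_right_mono by (fastforce simp: w_def)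
    finally have "\<gamma> * (w * b^2) \<le> \<gamma> * (norm z ^ 2 / \<mu>)"
      by (rule mult_left_mono) (use \<gamma>_pos in simp)
    moreover have "\<gamma> * w * (2 * a * b) \<le> \<gamma> * w * (a^2 + b^2)"
      using sum_squares_bound[of a b] \<gamma>_pos weight_pos[of "\<phi> t"]
      by (intro mult_left_mono) (auto simp: w_def algebra_simps)
    ultimately show ?thesis by (simp add: algebra_simps)
  qed
  finally show ?thesis by (simp add: e_def z_def)
qed

lemma lyapunov_lower: "norm (q - (\<theta>s, \<theta>s))^2 / 6 \<le> lyapunov q"
proof -
  have "norm (fst q - \<theta>s)^2 \<le> 2 * norm (snd q - \<theta>s)^2 + 2 * norm (fst q - snd q)^2"
    using norm_add_power2_le[of "snd q - \<theta>s" "fst q - snd q"] by simp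
  moreover have "0 \<le> \<gamma> / \<beta> * data_energy (fst q - \<theta>s)"
    using data_energy_nonneg \<gamma>_pos \<beta>_pos by simp
  moreover have "0 \<le> norm (fst q - snd q)^2" by simp
  ultimately show ?thesis unfolding lyapunov_def power2_norm_diff_Pair add_divide_distrib by linarith
qed

lemma error_le_state:
  "norm (fst q - \<theta>s)^2 + norm (fst q - snd q)^2 \<le> 3 * norm (q - (\<theta>s, \<theta>s))^2"
proof -
  have "norm (fst q - snd q)^2 \<le> 2 * norm (fst q - \<theta>s)^2 + 2 * norm (snd q - \<theta>s)^2"
    using norm_add_power2_le[of "fst q - \<theta>s" "- (snd q - \<theta>s)"] by (simp add: norm_minus_commute)
  moreover have "0 \<le> norm (snd q - \<theta>s)^2" by simp
  ultimately show ?thesis unfolding power2_norm_diff_Pair distrib_left by linarith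
qed

lemma lyapunov_le_error:
  obtains K where "K > 0"
    and "\<And>q. lyapunov q \<le> K * (norm (fst q - \<theta>s)^2 + norm (fst q - snd q)^2)"
proof
  define P where "P = (\<Sum>k\<in>UNIV. norm (\<phi> (ts k))^2)"
  have "P \<ge> 0" by (simp add: P_def sum_nonneg)
  thus "2 + \<gamma> / \<beta> * P > 0" using \<gamma>_pos \<beta>_pos by (simp add: add_pos_nonneg)
  fix q
  have "norm (snd q - \<theta>s)^2 \<le> 2 * norm (fst q - \<theta>s)^2 + 2 * norm (fst q - snd q)^2"
    using norm_add_power2_le[of "fst q - \<theta>s" "- (fst q - snd q)"] by (simp add: norm_minus_commute)
  moreover have "\<gamma> / \<beta> * data_energy (fst q - \<theta>s) \<le> \<gamma> / \<beta> * (P * norm (fst q - \<theta>s)^2)"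
    using data_energy_le \<gamma>_pos \<beta>_pos by (intro mult_left_mono) (auto simp: P_def)
  moreover have "0 \<le> \<gamma> / \<beta> * (P * norm (fst q - snd q)^2)"
    using \<open>P \<ge> 0\<close> \<gamma>_pos \<beta>_pos by simp
  moreover have "(2 + \<gamma> / \<beta> * P) * (norm (fst q - \<theta>s)^2 + norm (fst q - snd q)^2)
      = 2 * norm (fst q - \<theta>s)^2 + 2 * norm (fst q - snd q)^2
        + \<gamma> / \<beta> * (P * norm (fst q - \<theta>s)^2) + \<gamma> / \<beta> * (P * norm (fst q - snd q)^2)"
    by (simp add: algebra_simps)
  moreover have "0 \<le> norm (fst q - \<theta>s)^2" "0 \<le> norm (fst q - snd q)^2" by simp_all
  ultimately show "lyapunov q \<le> (2 + \<gamma> / \<beta> * P) * (norm (fst q - \<theta>s)^2 + norm (fst q - snd q)^2)"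
    unfolding lyapunov_def by linarith
qed

lemma lyapunov_decrease:
  obtains \<kappa> where "\<kappa> > 0" and "\<And>q t. lyapunov_deriv q (vector_field q t) \<le> - \<kappa> * lyapunov q"
proof -
  obtain c where c: "c > 0" "\<And>e. c * norm e ^ 2 \<le> data_energy e"
    using data_energy_coercive by blast
  obtain K where K: "K > 0"
    "\<And>q. lyapunov q \<le> K * (norm (fst q - \<theta>s)^2 + norm (fst q - snd q)^2)"
    using lyapunov_le_error by blast
  define m where "m = min (\<gamma> / \<mu>) (\<gamma> * c)"
  have m: "m > 0" using \<gamma>_pos \<mu>_pos c(1) by (simp add: m_def)
  show thesis
  proof
    show "m / K > 0" using m K(1) by simp
    fix q :: "(real^'n) \<times> (real^'n)" and t
    have "\<gamma> / \<mu> \<le> \<beta> - \<gamma> / \<mu>" using \<beta>_ge by simp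
    hence "m * norm (fst q - snd q)^2 \<le> (\<beta> - \<gamma> / \<mu>) * norm (fst q - snd q)^2"
      by (intro mult_right_mono) (auto simp: m_def)
    moreover have "m * norm (fst q - \<theta>s)^2 \<le> \<gamma> * c * norm (fst q - \<theta>s)^2"
      by (intro mult_right_mono) (auto simp: m_def)
    moreover have "\<gamma> * c * norm (fst q - \<theta>s)^2 \<le> \<gamma> * data_energy (fst q - \<theta>s)"
      using c(2) \<gamma>_pos by (simp add: mult.assoc)
    ultimately have "lyapunov_deriv q (vector_field q t)
        \<le> - m * (norm (fst q - \<theta>s)^2 + norm (fst q - snd q)^2)"
      using lyapunov_deriv_vector_field[of q t] by (simp add: algebra_simps)
    also have "\<dots> \<le> - (m / K) * lyapunov q"
      using mult_left_mono[OF K(2)[of q], of "m / K"] m K(1) by (simp add: field_simps)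
    finally show "lyapunov_deriv q (vector_field q t) \<le> - (m / K) * lyapunov q" .
  qed
qed

lemma vector_field_piecewise_continuous: "piecewise_continuous_in_time vector_field"
  unfolding piecewise_continuous_in_time_def
proof (intro allI impI)
  fix T :: real assume "0 \<le> T"
  then obtain S where "finite S" and S: "\<forall>s\<in>{0..T} - S. continuous (at s within {0..}) \<phi>"
    using \<phi>_pc unfolding piecewise_continuous_nonneg_def by blast
  have "continuous (at s within A) (\<lambda>u. vector_field (y u) u)"
    if "s \<in> {0..T} - S" "A \<subseteq> {0..}" "continuous (at s within A) y"
    for s and y :: "real \<Rightarrow> (real^'n) \<times> (real^'n)" and A
  proof -
    have "continuous (at s within A) \<phi>" using S that continuous_within_subset by blast
    moreover have "1 + \<mu> * (\<phi> u \<bullet> \<phi> u) \<noteq> 0" for u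
      using weight_denominator_ge_one[of "\<phi> u"] by linarith
    ultimately show ?thesis
      unfolding vector_field_eq weight_def using that(3) by (intro continuous_intros) auto
  qed
  with \<open>finite S\<close> show "\<exists>S. finite S \<and> (\<forall>s\<in>{0..T} - S. \<forall>y A. A \<subseteq> {0..} \<longrightarrow>
      continuous (at s within A) y \<longrightarrow> continuous (at s within A) (\<lambda>u. vector_field (y u) u))"
    by blast
qed

theorem UGAS_vector_field: "UGAS vector_field (\<theta>s, \<theta>s)"
proof -
  obtain \<kappa> where "\<kappa> > 0" and decrease: "\<And>q t. lyapunov_deriv q (vector_field q t) \<le> - \<kappa> * lyapunov q"
    using lyapunov_decrease by blast
  obtain K where "K > 0"
    and K: "\<And>q. lyapunov q \<le> K * (norm (fst q - \<theta>s)^2 + norm (fst q - snd q)^2)"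
    using lyapunov_le_error by blast
  have "lyapunov q \<le> 3 * K * norm (q - (\<theta>s, \<theta>s))^2" for q
    using K[of q] mult_left_mono[OF error_le_state[of q] less_imp_le[OF \<open>K > 0\<close>]] by linarith
  with lyapunov_lower show ?thesis
    by (intro UGAS_if_quadratic_lyapunov[OF vector_field_piecewise_continuous has_derivative_lyapunov
          decrease \<open>\<kappa> > 0\<close>, of "1 / 6"]) auto
qed

end

theorem theorem4:
  fixes \<theta>s :: "real^'n" and \<phi> :: "real \<Rightarrow> real^'n" and M :: real
    and ts :: "'m::finite \<Rightarrow> real"
    and \<beta> \<gamma> \<mu> :: real
  assumes pc: "piecewise_continuous_nonneg \<phi>"
    and M_pos: "M > 0" and bound: "\<forall>t\<ge>0. norm (\<phi> t) \<le> M"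
    and ts_nonneg: "\<forall>k. ts k \<ge> 0"
    and rank_D: "rank ((\<chi> i k. \<phi> (ts k) $ i) :: real^'m^'n) = CARD('n)"
    and \<beta>_pos: "\<beta> > 0" and \<gamma>_pos: "\<gamma> > 0" and \<mu>_pos: "\<mu> > 0"
    and \<beta>_ge: "\<beta> \<ge> 2 * \<gamma> / \<mu>"
  shows "UGAS
    (\<lambda>(\<theta>, \<theta>v) t.
       let ys = (\<lambda>s. \<phi> s \<bullet> \<theta>s);
           B = (\<Sum>k\<in>UNIV. (1 / (1 + \<mu> * (\<phi> (ts k) \<bullet> \<phi> (ts k)))) *\<^sub>R
                   ((\<phi> (ts k) \<bullet> \<theta> - ys (ts k)) *\<^sub>R \<phi> (ts k)))
       in (- \<beta> *\<^sub>R (\<theta> - \<theta>v),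
           - \<gamma> *\<^sub>R ((1 / (1 + \<mu> * (\<phi> t \<bullet> \<phi> t))) *\<^sub>R
                        ((\<phi> t \<bullet> \<theta> - ys t) *\<^sub>R \<phi> t) + B)))
    (\<theta>s, \<theta>s)"
proof -
  interpret concurrent_learning \<theta>s \<phi> ts \<beta> \<gamma> \<mu>
    using pc rank_D \<beta>_pos \<gamma>_pos \<mu>_pos \<beta>_ge by unfold_locales
  show ?thesis using UGAS_vector_field unfolding vector_field_def .
qed

end
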